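(* Every $3$-edge-connected graph $G$ satisfies $f(G)\leq 7$.
   Context: Graphs are finite and undirected; parallel edges are allowed. For a graph $G=(V,E)$ and $X\subseteq V$, $\delta_G(X)$ is the set of edges with exactly one endvertex in $X$, and $G$ is $k$-edge-connected if $|\delta_G(X)|\ge k$ for every nonempty proper subset $X$ of $V$. An orientation of $G$ replaces each edge $uv$ by exactly one of the arcs $uv$ or $vu$; for $e\in E$, $\vec e$ denotes the corresponding arc. A digraph is strongly connected if for every nonempty proper vertex subset $X$ some arc leaves $X$. For a $3$-edge-connected graph $G$, the Frank number $f(G)$ is the minimum integer $k$ such that there exist $k$ orientations $D_1,\dots,D_k$ of $G$ with the property that for every edge $e$ of $G$ there is an $i$ with $D_i-\vec e$ strongly connected. *)

theory Defs
  imports "Graph_Theory.Graph_Theory" "HOL-Library.Extended_Nat"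
begin

text \<open>
  Edges have their own identities, so distinct edges may have the same set of endvertices
  (parallel edges). Every edge has two distinct endvertices, i.e. there are no loops.
\<close>

record ('v, 'e) mgraph =
  mverts :: "'v set"
  medges :: "'e set"
  mends :: "'e \<Rightarrow> 'v set"

locale multigraph =
  fixes G :: "('v, 'e) mgraph"
  assumes finite_mverts: "finite (mverts G)"
    and finite_medges: "finite (medges G)"
    and mends_subset: "e \<in> medges G \<Longrightarrow> mends G e \<subseteq> mverts G"
    and card_mends: "e \<in> medges G \<Longrightarrow> card (mends G e) = 2"

definition cut :: "('v, 'e) mgraph \<Rightarrow> 'v set \<Rightarrow> 'e set" where
  "cut G X = {e \<in> medges G. card (mends G e \<inter> X) = 1}"

definition edge_connected :: "nat \<Rightarrow> ('v, 'e) mgraph \<Rightarrow> bool" where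
  "edge_connected k G \<longleftrightarrow> (\<forall>X. X \<noteq> {} \<and> X \<subset> mverts G \<longrightarrow> k \<le> card (cut G X))"

text \<open>The arc obtained from an edge \<open>e\<close> keeps the name \<open>e\<close>.\<close>

definition orientation :: "('v, 'e) mgraph \<Rightarrow> ('v, 'e) pre_digraph \<Rightarrow> bool" where
  "orientation G D \<longleftrightarrow> verts D = mverts G \<and> arcs D = medges G \<and>
     (\<forall>e \<in> medges G. {tail D e, head D e} = mends G e)"

definition strong :: "('v, 'e) pre_digraph \<Rightarrow> bool" where
  "strong D \<longleftrightarrow> (\<forall>X. X \<noteq> {} \<and> X \<subset> verts D \<longrightarrow>
     (\<exists>a \<in> arcs D. tail D a \<in> X \<and> head D a \<notin> X))"

text \<open>
  On nonempty digraphs this is the notion of \<^theory>\<open>Graph_Theory.Digraph_Component\<close>,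
  which is defined through reachability.
\<close>

lemma (in wf_digraph) strong_iff_strongly_connected:
  assumes "verts G \<noteq> {}"
  shows "strong G \<longleftrightarrow> strongly_connected G"
proof
  assume s: "strong G"
  show "strongly_connected G"
  proof (rule strongly_connectedI[OF assms])
    fix u v assume uv: "u \<in> verts G" "v \<in> verts G"
    let ?X = "{w. u \<rightarrow>\<^sup>* w}"
    have sub: "?X \<subseteq> verts G" using reachable_in_verts by blast
    have ne: "?X \<noteq> {}" using uv by blast
    have "?X = verts G"
    proof (rule ccontr)
      assume "?X \<noteq> verts G"
      with sub ne s obtain a where a: "a \<in> arcs G" "tail G a \<in> ?X" "head G a \<notin> ?X"
        unfolding strong_def by (metis psubsetI)
      have "tail G a \<rightarrow> head G a" using a(1) by (auto simp: arcs_ends_conv)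
      with a show False using reachable_adj_trans by blast
    qed
    with uv show "u \<rightarrow>\<^sup>* v" by blast
  qed
next
  assume s: "strongly_connected G"
  show "strong G"
    unfolding strong_def
  proof (intro allI impI)
    fix X assume X: "X \<noteq> {} \<and> X \<subset> verts G"
    then obtain u v where uv: "u \<in> X" "u \<in> verts G" "v \<in> verts G" "v \<notin> X" by blast
    show "\<exists>a \<in> arcs G. tail G a \<in> X \<and> head G a \<notin> X"
    proof (rule ccontr)
      assume no: "\<not> ?thesis"
      have "u \<rightarrow>\<^sup>* v" using s uv by blast
      then have "v \<in> X"
      proof (induct rule: reachable_induct)
        case base
        show ?case by fact
      next
        case (step x y)
        then show ?case using no by (metis reachableE)
      qed
      with uv show False by blast
    qed
  qed
qed

definition frank_orientations :: "('v, 'e) mgraph \<Rightarrow> nat \<Rightarrow> bool" where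
  "frank_orientations G k \<longleftrightarrow> (\<exists>D :: nat \<Rightarrow> ('v, 'e) pre_digraph.
     (\<forall>i \<in> {1..k}. orientation G (D i)) \<and>
     (\<forall>e \<in> medges G. \<exists>i \<in> {1..k}. strong (pre_digraph.del_arc (D i) e)))"

text \<open>
  The minimum is taken in the extended naturals, where the infimum of a nonempty set of
  naturals is its least element; it is \<open>\<infinity>\<close> if no number of orientations suffices.
\<close>

definition frank_number :: "('v, 'e) mgraph \<Rightarrow> enat" where
  "frank_number G = (INF k \<in> {k. frank_orientations G k}. enat k)"

lemma frank_number_eq_Least:
  assumes "frank_orientations G k"
  shows "frank_number G = enat (LEAST k. frank_orientations G k)"
  unfolding frank_number_def
  by (rule antisym)
     (use assms in \<open>auto intro!: INF_lower INF_greatest intro: LeastI Least_le\<close>)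

end

theory Submission
  imports Defs
begin

text \<open>
  By Jaeger's 8-flow theorem, \<open>G\<close> has a nowhere zero \<open>\<int>\<^sub>2\<^sup>3\<close>-flow, i.e. its edges are covered by
  three even sets \<open>A\<close>, \<open>B\<close>, \<open>C\<close>. Each even set carries an integer flow with values \<open>1\<close> and
  \<open>-1\<close>; let \<open>a\<close>, \<open>b\<close>, \<open>c\<close> be such flows. Then \<open>a + 2b + 4c\<close> is nowhere zero, and it is \<open>1\<close> or
  \<open>-1\<close> on the edges that are only in \<open>A\<close>. In the orientation that makes the flow positive, arcs
  of value \<open>1\<close> are deletable because all cuts have at least three edges. A change of basis
  moves any of the seven nonzero elements of \<open>\<int>\<^sub>2\<^sup>3\<close> to \<open>(1, 0, 0)\<close>, so seven orientations suffice.

  The covering is obtained as in Seymour's proof of the 6-flow theorem: one grows an even set \<open>C\<close>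
  such that all edges are reached from \<open>C\<close> by successively adding at most two edges that lie in
  an even set whose other edges are already present.
\<close>

section \<open>Cuts and even edge sets\<close>

definition boundary :: "('e \<Rightarrow> 'v) \<Rightarrow> ('e \<Rightarrow> 'v) \<Rightarrow> 'e set \<Rightarrow> 'v set \<Rightarrow> 'e set" where
  "boundary t h F X = {e \<in> F. (t e \<in> X) \<noteq> (h e \<in> X)}"

definition odd_at :: "('e \<Rightarrow> 'v) \<Rightarrow> ('e \<Rightarrow> 'v) \<Rightarrow> 'e set \<Rightarrow> 'v \<Rightarrow> bool" where
  "odd_at t h Z v \<longleftrightarrow> odd (card (boundary t h Z {v}))"

text \<open>For finite edge sets these are the elements of the cycle space over the field with two
  elements, with \<open>sym_diff\<close> as addition.\<close>

definition even_set :: "('e \<Rightarrow> 'v) \<Rightarrow> ('e \<Rightarrow> 'v) \<Rightarrow> 'e set \<Rightarrow> bool" where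
  "even_set t h Z \<longleftrightarrow> (\<forall>v. \<not> odd_at t h Z v)"

definition induced :: "('e \<Rightarrow> 'v) \<Rightarrow> ('e \<Rightarrow> 'v) \<Rightarrow> 'e set \<Rightarrow> 'v set \<Rightarrow> 'e set" where
  "induced t h F U = {e \<in> F. t e \<in> U \<and> h e \<in> U}"

text \<open>Cut form of the condition that \<open>U\<close> lies in one component of the graph with
  edge set \<open>F\<close>; no paths are needed.\<close>

definition connects :: "('e \<Rightarrow> 'v) \<Rightarrow> ('e \<Rightarrow> 'v) \<Rightarrow> 'e set \<Rightarrow> 'v set \<Rightarrow> bool" where
  "connects t h F U \<longleftrightarrow> (\<forall>X. U \<inter> X \<noteq> {} \<longrightarrow> U - X \<noteq> {} \<longrightarrow> boundary t h F X \<noteq> {})"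

lemma finite_boundary [simp]: "finite F \<Longrightarrow> finite (boundary t h F X)"
  by (simp add: boundary_def)

lemma boundary_Compl: "boundary t h F (- X) = boundary t h F X"
  by (auto simp: boundary_def)

lemma boundary_sym_diff:
  "boundary t h (sym_diff A B) X = sym_diff (boundary t h A X) (boundary t h B X)"
  by (auto simp: boundary_def)

lemma card_sym_diff:
  assumes "finite A" "finite B"
  shows "card (sym_diff A B) + 2 * card (A \<inter> B) = card A + card B"
proof -
  have "card (sym_diff A B) = card (A - B) + card (B - A)"
    using assms by (intro card_Un_disjoint) auto
  moreover have "card A = card (A \<inter> B) + card (A - B)" "card B = card (B \<inter> A) + card (B - A)"
    using assms by (simp_all only: card_Int_Diff)
  ultimately show ?thesis by (simp add: Int_commute)
qed

lemma odd_at_sym_diff: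
  assumes "finite A" "finite B"
  shows "odd_at t h (sym_diff A B) v \<longleftrightarrow> (odd_at t h A v \<noteq> odd_at t h B v)"
proof -
  have "card (boundary t h (sym_diff A B) {v}) +
        2 * card (boundary t h A {v} \<inter> boundary t h B {v}) =
        card (boundary t h A {v}) + card (boundary t h B {v})"
    unfolding boundary_sym_diff by (rule card_sym_diff) (use assms in auto)
  moreover have "odd a \<longleftrightarrow> (odd c \<noteq> odd d)" if "a + 2 * b = c + d" for a b c d :: nat
    using that by presburger
  ultimately show ?thesis unfolding odd_at_def by blast
qed

lemma odd_at_empty [simp]: "\<not> odd_at t h {} v"
  by (simp add: odd_at_def boundary_def)

lemma odd_at_singleton [simp]: "odd_at t h {e} v \<longleftrightarrow> (v = t e) \<noteq> (v = h e)"
proof -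
  have "boundary t h {e} {v} = (if (v = t e) \<noteq> (v = h e) then {e} else {})"
    by (auto simp: boundary_def)
  then show ?thesis by (simp add: odd_at_def)
qed

lemma odd_at_disjoint_Un:
  assumes "finite A" "finite B" "A \<inter> B = {}"
  shows "odd_at t h (A \<union> B) v \<longleftrightarrow> (odd_at t h A v \<noteq> odd_at t h B v)"
proof -
  have "sym_diff A B = A \<union> B" using assms(3) by blast
  with odd_at_sym_diff[OF assms(1,2)] show ?thesis by metis
qed

lemma even_set_empty [simp]: "even_set t h {}"
  by (simp add: even_set_def)

lemma even_set_sym_diff:
  "finite A \<Longrightarrow> finite B \<Longrightarrow> even_set t h A \<Longrightarrow> even_set t h B \<Longrightarrow> even_set t h (sym_diff A B)"
  by (simp add: even_set_def odd_at_sym_diff)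

text \<open>\<open>R\<close> collects the possible second ends of a join from \<open>a\<close>.
  Toggling an edge of \<open>F\<close> at the end of a join moves that end along the edge, so no
  edge of \<open>F\<close> leaves \<open>R\<close> and \<open>b\<close> must belong to it.\<close>

lemma ex_join:
  assumes fin: "finite F" and sep: "\<And>X. a \<in> X \<Longrightarrow> b \<notin> X \<Longrightarrow> boundary t h F X \<noteq> {}"
  shows "\<exists>J \<subseteq> F. \<forall>v. odd_at t h J v \<longleftrightarrow> (v = a) \<noteq> (v = b)"
proof -
  define R where "R = {c. \<exists>J \<subseteq> F. \<forall>v. odd_at t h J v \<longleftrightarrow> (v = a) \<noteq> (v = c)}"
  have "a \<in> R" unfolding R_def by (intro CollectI exI[of _ "{}"]) auto
  have step: "d \<in> R" if "c \<in> R" "e \<in> F" "{t e, h e} = {c, d}" for c d e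
  proof -
    obtain J where J: "J \<subseteq> F" "\<And>v. odd_at t h J v \<longleftrightarrow> (v = a) \<noteq> (v = c)"
      using \<open>c \<in> R\<close> unfolding R_def by blast
    have "odd_at t h (sym_diff J {e}) v \<longleftrightarrow> (v = a) \<noteq> (v = d)" for v
      using J finite_subset[OF J(1) fin] that(3)
      by (subst odd_at_sym_diff) (auto simp: doubleton_eq_iff)
    moreover have "sym_diff J {e} \<subseteq> F" using J that by auto
    ultimately show ?thesis unfolding R_def by blast
  qed
  have "boundary t h F R = {}"
  proof (rule equals0I)
    fix e assume "e \<in> boundary t h F R"
    then show False using step[of "t e" e "h e"] step[of "h e" e "t e"]
      by (auto simp: boundary_def)
  qed
  then have "b \<in> R" using sep[of R] \<open>a \<in> R\<close> by blast
  then show ?thesis unfolding R_def by simp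
qed

lemma connects_join:
  assumes "finite F" "connects t h F U" "a \<in> U" "b \<in> U"
  obtains J where "J \<subseteq> F" "\<And>v. odd_at t h J v \<longleftrightarrow> (v = a) \<noteq> (v = b)"
proof -
  have "\<exists>J \<subseteq> F. \<forall>v. odd_at t h J v \<longleftrightarrow> (v = a) \<noteq> (v = b)"
    by (rule ex_join) (use assms in \<open>auto simp: connects_def\<close>)
  then show thesis by (elim exE conjE) (rule that, assumption, erule spec)
qed

section \<open>Minimal edge sets joining two vertices 2-edge-connectedly\<close>

text \<open>For finite \<open>K\<close> and distinct \<open>x\<close>, \<open>y\<close> this says,
  by Menger's theorem, that \<open>K\<close> contains two edge-disjoint paths from \<open>x\<close>
  to \<open>y\<close>. The cut form suits uncrossing.\<close>

definition two_joined :: "('e \<Rightarrow> 'v) \<Rightarrow> ('e \<Rightarrow> 'v) \<Rightarrow> 'e set \<Rightarrow> 'v \<Rightarrow> 'v \<Rightarrow> bool" where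
  "two_joined t h K x y \<longleftrightarrow> (\<forall>X. x \<in> X \<longrightarrow> y \<notin> X \<longrightarrow> 2 \<le> card (boundary t h K X))"

definition tight :: "('e \<Rightarrow> 'v) \<Rightarrow> ('e \<Rightarrow> 'v) \<Rightarrow> 'e set \<Rightarrow> 'v \<Rightarrow> 'v \<Rightarrow> 'v set \<Rightarrow> bool" where
  "tight t h K x y X \<longleftrightarrow> x \<in> X \<and> y \<notin> X \<and> card (boundary t h K X) = 2"

lemma two_joined_commute: "two_joined t h K x y \<Longrightarrow> two_joined t h K y x"
  unfolding two_joined_def by (metis ComplI ComplD boundary_Compl)

lemma tight_Compl: "tight t h K x y X \<Longrightarrow> tight t h K y x (- X)"
  unfolding tight_def by (simp add: boundary_Compl)

text \<open>An edge crossing the intersection or the union crosses \<open>X\<close> or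
  \<open>Y\<close>, and an edge crossing both of them crosses \<open>X\<close> and
  \<open>Y\<close>.\<close>

lemma boundary_submodular:
  assumes "finite K"
  shows "card (boundary t h K (X \<inter> Y)) + card (boundary t h K (X \<union> Y))
    \<le> card (boundary t h K X) + card (boundary t h K Y)"
proof -
  have "card (boundary t h K (X \<inter> Y) \<union> boundary t h K (X \<union> Y))
      \<le> card (boundary t h K X \<union> boundary t h K Y)"
    by (rule card_mono) (use assms in \<open>auto simp: boundary_def\<close>)
  moreover have "card (boundary t h K (X \<inter> Y) \<inter> boundary t h K (X \<union> Y))
      \<le> card (boundary t h K X \<inter> boundary t h K Y)"
    by (rule card_mono) (use assms in \<open>auto simp: boundary_def\<close>)
  ultimately show ?thesis
    using card_Un_Int[of "boundary t h K (X \<inter> Y)" "boundary t h K (X \<union> Y)"]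
      card_Un_Int[of "boundary t h K X" "boundary t h K Y"] assms by simp
qed

lemma tight_Int:
  assumes "finite K" "two_joined t h K x y" "tight t h K x y X" "tight t h K x y Y"
  shows "tight t h K x y (X \<inter> Y)"
proof -
  have "2 \<le> card (boundary t h K (X \<inter> Y))" "2 \<le> card (boundary t h K (X \<union> Y))"
    using assms unfolding two_joined_def tight_def by auto
  then show ?thesis using boundary_submodular[OF assms(1), of t h X Y] assms(3,4)
    unfolding tight_def by auto
qed

text \<open>An edge at \<open>v\<close> that crosses a set containing \<open>v\<close> has its other
  end outside, so it still crosses after intersecting with further sets containing \<open>v\<close>.
  Intersections stay tight by uncrossing.\<close>

lemma tight_common:
  assumes fin: "finite K" and P: "two_joined t h K x y"
    and S: "finite S" "S \<noteq> {}" "S \<subseteq> boundary t h K {v}"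
    and ex: "\<And>e. e \<in> S \<Longrightarrow> \<exists>X. tight t h K x y X \<and> v \<in> X \<and> e \<in> boundary t h K X"
  shows "\<exists>Y. tight t h K x y Y \<and> v \<in> Y \<and> S \<subseteq> boundary t h K Y"
  using S ex
proof (induction S rule: finite_ne_induct)
  case (singleton e)
  then show ?case by simp
next
  case (insert e S)
  then obtain Y where Y: "tight t h K x y Y" "v \<in> Y" "S \<subseteq> boundary t h K Y" by auto
  obtain X where X: "tight t h K x y X" "v \<in> X" "e \<in> boundary t h K X"
    using insert.prems by blast
  have "insert e S \<subseteq> boundary t h K (X \<inter> Y)"
    using insert.prems(1) X(2,3) Y(2,3) by (auto simp: boundary_def)
  then show ?case using tight_Int[OF fin P X(1) Y(1)] X(2) Y(2) by blast
qed

text \<open>Since \<open>v\<close> is not \<open>x\<close>, removing \<open>v\<close> from the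
  common tight set \<open>Y\<close> leaves a set that still separates \<open>x\<close> from
  \<open>y\<close>. Its boundary arises from the two edges of that of \<open>Y\<close> by toggling
  all edges at \<open>v\<close> and again has at least two edges, so at most half of the edges at
  \<open>v\<close> cross \<open>Y\<close>.\<close>

lemma tight_degree:
  assumes fin: "finite K" and P: "two_joined t h K x y" and "v \<noteq> x"
    and S: "S \<subseteq> boundary t h K {v}"
    and ex: "\<And>e. e \<in> S \<Longrightarrow> \<exists>X. tight t h K x y X \<and> v \<in> X \<and> e \<in> boundary t h K X"
  shows "2 * card S \<le> card (boundary t h K {v})"
proof (cases "S = {}")
  case False
  have finS: "finite S" using S fin finite_subset finite_boundary by metis
  from tight_common[OF fin P finS False S ex] obtain Y
    where Y: "tight t h K x y Y" "v \<in> Y" "S \<subseteq> boundary t h K Y" by blast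
  have eq: "boundary t h K (Y - {v}) = sym_diff (boundary t h K Y) (boundary t h K {v})"
    using Y(2) by (auto simp: boundary_def)
  have "2 \<le> card (boundary t h K (Y - {v}))"
    using P Y(1) \<open>v \<noteq> x\<close> unfolding two_joined_def tight_def by auto
  moreover have "card S \<le> card (boundary t h K Y \<inter> boundary t h K {v})"
    by (rule card_mono) (use fin S Y(3) in auto)
  ultimately show ?thesis
    using card_sym_diff[of "boundary t h K Y" "boundary t h K {v}"] fin Y(1)
    unfolding eq tight_def by auto
qed simp

text \<open>All tight sets contain \<open>x\<close>, so a single one is crossed by every edge at
  \<open>x\<close>. The degree of \<open>x\<close> is therefore exactly two.\<close>

lemma minimal_even_source:
  assumes fin: "finite K" and P: "two_joined t h K x y" and "x \<noteq> y"
    and tight: "\<And>e. e \<in> K \<Longrightarrow> \<exists>X. tight t h K x y X \<and> e \<in> boundary t h K X"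
  shows "\<not> odd_at t h K x"
proof -
  have two: "2 \<le> card (boundary t h K {x})"
    using P \<open>x \<noteq> y\<close> unfolding two_joined_def by auto
  have ex: "\<exists>X. tight t h K x y X \<and> x \<in> X \<and> e \<in> boundary t h K X"
    if "e \<in> boundary t h K {x}" for e
    using that tight[of e] unfolding tight_def boundary_def by blast
  have "boundary t h K {x} \<noteq> {}" using two by auto
  from tight_common[OF fin P _ this subset_refl ex] fin obtain Y
    where Y: "tight t h K x y Y" "boundary t h K {x} \<subseteq> boundary t h K Y" by auto
  then have "card (boundary t h K {x}) \<le> 2"
    using card_mono[OF _ Y(2)] fin unfolding tight_def by auto
  with two show ?thesis unfolding odd_at_def by simp
qed

text \<open>By submodularity a single tight set containing \<open>v\<close> handles all edges at \<open>v\<close> that leave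
  some tight set containing \<open>v\<close>. Hence these are at most half of the edges at \<open>v\<close>; so are, by
  complementation, the remaining ones, and the degree of \<open>v\<close> is even.\<close>

lemma minimal_even:
  assumes fin: "finite K" and P: "two_joined t h K x y" and "x \<noteq> y"
    and tight: "\<And>e. e \<in> K \<Longrightarrow> \<exists>X. tight t h K x y X \<and> e \<in> boundary t h K X"
  shows "even_set t h K"
  unfolding even_set_def
proof
  fix v
  note P' = two_joined_commute[OF P]
  have tight': "\<exists>X. tight t h K y x X \<and> e \<in> boundary t h K X" if "e \<in> K" for e
    using tight[OF that] tight_Compl boundary_Compl by metis
  consider "v = x" | "v = y" | "v \<noteq> x" "v \<noteq> y" by blast
  then show "\<not> odd_at t h K v"
  proof cases
    case 1
    then show ?thesis using minimal_even_source[OF fin P \<open>x \<noteq> y\<close> tight] by simp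
  next
    case 2
    then show ?thesis using minimal_even_source[OF fin P' _ tight'] \<open>x \<noteq> y\<close> by simp
  next
    case 3
    let ?d = "boundary t h K {v}"
    define A where "A = {e \<in> ?d. \<exists>X. tight t h K x y X \<and> v \<in> X \<and> e \<in> boundary t h K X}"
    define B where "B = {e \<in> ?d. \<exists>X. tight t h K y x X \<and> v \<in> X \<and> e \<in> boundary t h K X}"
    have "2 * card A \<le> card ?d"
      by (rule tight_degree[OF fin P 3(1)]) (auto simp: A_def)
    moreover have "2 * card B \<le> card ?d"
      by (rule tight_degree[OF fin P' 3(2)]) (auto simp: B_def)
    moreover have "?d \<subseteq> A \<union> B"
    proof
      fix e assume e: "e \<in> ?d"
      then obtain X where X: "tight t h K x y X" "e \<in> boundary t h K X"
        using tight[of e] by (auto simp: boundary_def)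
      show "e \<in> A \<union> B"
      proof (cases "v \<in> X")
        case True
        then show ?thesis using e X unfolding A_def by blast
      next
        case False
        then show ?thesis using e X tight_Compl[OF X(1)] boundary_Compl[of t h K X]
          unfolding B_def by blast
      qed
    qed
    then have "card ?d \<le> card A + card B"
      using card_mono[of "A \<union> B" ?d] card_Un_le[of A B] fin unfolding A_def B_def by auto
    ultimately have "card ?d = 2 * card A" by linarith
    then show ?thesis unfolding odd_at_def by simp
  qed
qed

text \<open>In an inclusion-minimal two-joining set \<open>K\<close>, deleting any edge spoils some
  cut, so each edge crosses a tight set and \<open>minimal_even\<close> applies. \<open>W\<close> is
  the component of \<open>x\<close> in \<open>K\<close>.\<close>

lemma ex_connected_even_set:
  assumes fin: "finite E" and P: "two_joined t h E x y" and "x \<noteq> y"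
  obtains K W where "K \<subseteq> E" "even_set t h K" "x \<in> W" "y \<in> W" "induced t h K W = K"
    "connects t h K W" "\<And>X. x \<in> X \<Longrightarrow> boundary t h K X = {} \<Longrightarrow> W \<subseteq> X"
proof -
  define \<K> where "\<K> = {K. K \<subseteq> E \<and> two_joined t h K x y}"
  have "finite \<K>" "\<K> \<noteq> {}" using fin P unfolding \<K>_def by auto
  then obtain K where K: "K \<in> \<K>" and min: "\<And>L. L \<in> \<K> \<Longrightarrow> L \<subseteq> K \<Longrightarrow> L = K"
    using finite_has_minimal[of \<K>] by metis
  have KE: "K \<subseteq> E" and KP: "two_joined t h K x y" using K unfolding \<K>_def by auto
  have finK: "finite K" using KE fin finite_subset by blast
  have tight: "\<exists>X. tight t h K x y X \<and> e \<in> boundary t h K X" if "e \<in> K" for e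
  proof -
    have "K - {e} \<notin> \<K>" using min[of "K - {e}"] that by blast
    then obtain X where X: "x \<in> X" "y \<notin> X" "card (boundary t h (K - {e}) X) < 2"
      unfolding \<K>_def two_joined_def using KE by (auto simp: not_le)
    have two: "2 \<le> card (boundary t h K X)" using KP X unfolding two_joined_def by blast
    have eq: "boundary t h (K - {e}) X = boundary t h K X - {e}" by (auto simp: boundary_def)
    have "e \<in> boundary t h K X" using X(3) two unfolding eq by (metis Diff_empty Diff_insert0 not_le)
    moreover have "card (boundary t h K X) = 2" using X(3) two calculation finK unfolding eq
      by (simp add: card_Diff_singleton)
    ultimately show ?thesis using X unfolding tight_def by blast
  qed
  define W where "W = \<Inter> {X. x \<in> X \<and> boundary t h K X = {}}"
  have "x \<in> W" unfolding W_def by blast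
  have W_sub: "W \<subseteq> X" if "x \<in> X" "boundary t h K X = {}" for X
    using that unfolding W_def by blast
  have "y \<in> W" unfolding W_def using KP unfolding two_joined_def by fastforce
  have closed: "boundary t h K W = {}"
    unfolding W_def boundary_def by blast
  have conn: "connects t h K W"
    unfolding connects_def
  proof (intro allI impI notI)
    fix X assume X: "W \<inter> X \<noteq> {}" "W - X \<noteq> {}" "boundary t h K X = {}"
    show False
    proof (cases "x \<in> X")
      case True
      then show ?thesis using W_sub[OF _ X(3)] X(2) by blast
    next
      case False
      then show ?thesis using W_sub[of "- X"] X(1,3) boundary_Compl[of t h K X] by blast
    qed
  qed
  \<comment> \<open>As no edge of \<open>K\<close> leaves \<open>W\<close>, the edges of
    \<open>K\<close> inside \<open>W\<close> already join \<open>x\<close> and \<open>y\<close>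
    twice; minimality makes them all of \<open>K\<close>.\<close>
  have "induced t h K W \<in> \<K>"
    unfolding \<K>_def two_joined_def
  proof (intro CollectI conjI allI impI)
    show "induced t h K W \<subseteq> E" using KE by (auto simp: induced_def)
    fix X assume X: "x \<in> X" "y \<notin> X"
    have "boundary t h K (X \<inter> W) \<subseteq> boundary t h (induced t h K W) X"
      using closed by (auto simp: boundary_def induced_def)
    moreover have "2 \<le> card (boundary t h K (X \<inter> W))"
      using KP X \<open>x \<in> W\<close> unfolding two_joined_def by blast
    moreover have "finite (boundary t h (induced t h K W) X)"
      using finK by (simp add: boundary_def induced_def)
    ultimately show "2 \<le> card (boundary t h (induced t h K W) X)"
      using card_mono le_trans by blast
  qed
  then have "induced t h K W = K" using min by (auto simp: induced_def)
  with that[OF KE minimal_even[OF finK KP \<open>x \<noteq> y\<close> tight] \<open>x \<in> W\<close> \<open>y \<in> W\<close> _ conn W_sub]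
  show ?thesis by blast
qed

section \<open>Three even sets covering all edges\<close>

definition pair_coverable :: "('e \<Rightarrow> 'v) \<Rightarrow> ('e \<Rightarrow> 'v) \<Rightarrow> 'e set \<Rightarrow> 'e set \<Rightarrow> bool" where
  "pair_coverable t h E F \<longleftrightarrow>
    (\<exists>P Q. P \<subseteq> E \<and> Q \<subseteq> E \<and> even_set t h P \<and> even_set t h Q \<and> E - F \<subseteq> P \<union> Q)"

text \<open>A pair of even sets is a \<open>\<int>\<^sub>2\<^sup>2\<close>-flow. Adding one of the four multiples of the even set \<open>Z\<close>
  to it, we can avoid the value zero on two given edges of \<open>Z\<close>.\<close>

lemma pair_coverable_step:
  assumes fin: "finite E" and "F \<subseteq> E" and Z: "even_set t h Z" "Z \<subseteq> F \<union> {e, e'}"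
    and N: "{e, e'} \<subseteq> Z" "{e, e'} \<subseteq> E" and g: "pair_coverable t h E (F \<union> {e, e'})"
  shows "pair_coverable t h E F"
proof -
  obtain P Q where PQ: "P \<subseteq> E" "Q \<subseteq> E" "even_set t h P" "even_set t h Q"
    and cov: "E - (F \<union> {e, e'}) \<subseteq> P \<union> Q"
    using g unfolding pair_coverable_def by blast
  have ZE: "Z \<subseteq> E" using Z N \<open>F \<subseteq> E\<close> by blast
  note fins = finite_subset[OF PQ(1) fin] finite_subset[OF PQ(2) fin] finite_subset[OF ZE fin]
  have PQ': "sym_diff P Z \<subseteq> E" "sym_diff Q Z \<subseteq> E"
    "even_set t h (sym_diff P Z)" "even_set t h (sym_diff Q Z)"
    using PQ ZE Z(1) fins by (auto intro!: even_set_sym_diff)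
  have cov': "E - F \<subseteq> P' \<union> Q'"
    if "P' = P \<or> P' = sym_diff P Z" "Q' = Q \<or> Q' = sym_diff Q Z" "{e, e'} \<subseteq> P' \<union> Q'" for P' Q'
    using that cov Z(2) by blast
  \<comment> \<open>Adding \<open>Z\<close> to \<open>P\<close> or \<open>Q\<close> toggles both
    edges there. Each edge is missed by exactly one of the four choices, so two edges rule out at
    most two.\<close>
  have "{e, e'} \<subseteq> P \<union> Q \<or> {e, e'} \<subseteq> sym_diff P Z \<union> Q \<or> {e, e'} \<subseteq> P \<union> sym_diff Q Z
    \<or> {e, e'} \<subseteq> sym_diff P Z \<union> sym_diff Q Z"
    using N(1) by blast
  then obtain P' Q' where c: "P' = P \<or> P' = sym_diff P Z" "Q' = Q \<or> Q' = sym_diff Q Z"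
    "{e, e'} \<subseteq> P' \<union> Q'"
    by blast
  have "P' \<subseteq> E" "even_set t h P'" "Q' \<subseteq> E" "even_set t h Q'"
    using c(1,2) PQ PQ' by (elim disjE; simp)+
  with cov'[OF c] show ?thesis unfolding pair_coverable_def by blast
qed

text \<open>Each missing edge closes an even set with a join inside \<open>F\<close>. The edges are
  handled one at a time, by the previous lemma with both given edges equal.\<close>

lemma connects_pair_coverable:
  assumes fin: "finite E" and "F \<subseteq> E" and V: "\<And>e. e \<in> E \<Longrightarrow> t e \<in> V \<and> h e \<in> V"
    and conn: "connects t h F V"
  shows "pair_coverable t h E F"
  using \<open>F \<subseteq> E\<close> conn
proof (induction "card (E - F)" arbitrary: F rule: less_induct)
  case less
  show ?case
  proof (cases "E - F = {}")
    case True
    then show ?thesis unfolding pair_coverable_def by (intro exI[of _ "{}"]) auto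
  next
    case False
    then obtain e where e: "e \<in> E" "e \<notin> F" by blast
    have finF: "finite F" using less.prems fin finite_subset by blast
    obtain J where J: "J \<subseteq> F" "\<And>v. odd_at t h J v \<longleftrightarrow> (v = t e) \<noteq> (v = h e)"
      using connects_join[OF finF less.prems(2)] V[OF e(1)] by metis
    have "finite J" using J finF finite_subset by blast
    then have "even_set t h ({e} \<union> J)"
      unfolding even_set_def using J e by (subst odd_at_disjoint_Un) auto
    moreover have "pair_coverable t h E (F \<union> {e, e})"
    proof (rule less.hyps)
      show "card (E - (F \<union> {e, e})) < card (E - F)"
        by (rule psubset_card_mono) (use e fin in auto)
      show "F \<union> {e, e} \<subseteq> E" using e less.prems by auto
      show "connects t h (F \<union> {e, e}) V"
        using less.prems(2) unfolding connects_def boundary_def by blast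
    qed
    ultimately show ?thesis
      using J e less.prems by (intro pair_coverable_step[OF fin, of F t h "{e} \<union> J" e e]) auto
  qed
qed

text \<open>\<open>U\<close> grows by a disjoint set \<open>W\<close> that is connected by an even
  set \<open>K\<close> and linked to \<open>U\<close> by two edges. The final \<open>C\<close> is
  the union of all these \<open>K\<close>; its disjointness from the edges inside \<open>U\<close>
  is what keeps the union even.\<close>

lemma ex_disjoint_even_extension:
  assumes finE: "finite E" and finV: "finite V"
    and V: "\<And>e. e \<in> E \<Longrightarrow> t e \<in> V \<and> h e \<in> V"
    and con3: "\<And>X. X \<noteq> {} \<Longrightarrow> X \<subset> V \<Longrightarrow> 3 \<le> card (boundary t h E X)"
    and "U \<subseteq> V" "U \<noteq> {}" "F \<subseteq> induced t h E U" "connects t h F U"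
  shows "\<exists>C \<subseteq> E. even_set t h C \<and> C \<inter> induced t h E U = {} \<and> pair_coverable t h E (F \<union> C)"
  using assms(5-)
proof (induction "card (V - U)" arbitrary: U F rule: less_induct)
  case less
  note U = less.prems(1,2) and F = less.prems(3,4)
  have FE: "F \<subseteq> E" using F by (auto simp: induced_def)
  define link where "link e u w \<longleftrightarrow> e \<in> E \<and> {t e, h e} = {u, w}" for e u w
  have step: ?case
    if W: "W \<subseteq> V" "W \<inter> U = {}" and K: "K \<subseteq> induced t h E W" "even_set t h K" "connects t h K W"
      and e: "link e u x" "link e' u' y" "e \<noteq> e'" "u \<in> U" "u' \<in> U" "x \<in> W" "y \<in> W"
    for W K e e' u u' x y
  proof -
    let ?U = "U \<union> W" and ?F = "F \<union> K \<union> {e, e'}"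
    have eE: "e \<in> E" "e' \<in> E" using e unfolding link_def by auto
    have enU: "e \<notin> induced t h E U" "e' \<notin> induced t h E U"
      "e \<notin> induced t h E W" "e' \<notin> induced t h E W"
      using e W unfolding link_def induced_def doubleton_eq_iff by auto
    have FK: "F \<inter> K = {}" using F K W unfolding induced_def by blast
    have KE: "K \<subseteq> E" using K by (auto simp: induced_def)
    note finF = finite_subset[OF FE finE] and finK = finite_subset[OF KE finE]
    have sub: "?F \<subseteq> induced t h E ?U"
      using F(1) K(1) e unfolding induced_def link_def doubleton_eq_iff by auto
    have conn: "connects t h ?F ?U"
      unfolding connects_def
    proof (intro allI impI)
      fix X assume X: "?U \<inter> X \<noteq> {}" "?U - X \<noteq> {}"
      have "boundary t h F X \<noteq> {}" if "U \<inter> X \<noteq> {}" "U - X \<noteq> {}"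
        using F(2) that unfolding connects_def by blast
      moreover have "boundary t h K X \<noteq> {}" if "W \<inter> X \<noteq> {}" "W - X \<noteq> {}"
        using K(3) that unfolding connects_def by blast
      moreover have "e \<in> boundary t h {e} X" if "(u \<in> X) \<noteq> (x \<in> X)"
        using e(1) that unfolding link_def boundary_def doubleton_eq_iff by auto
      moreover have "boundary t h ?F X = boundary t h F X \<union> boundary t h K X
          \<union> boundary t h {e} X \<union> boundary t h {e'} X"
        by (auto simp: boundary_def)
      ultimately show "boundary t h ?F X \<noteq> {}" using X e by blast
    qed
    have smaller: "card (V - ?U) < card (V - U)"
      by (rule psubset_card_mono) (use finV W e in auto)
    have "?U \<subseteq> V" "?U \<noteq> {}" using U W(1) by auto
    from less.hyps[OF smaller this sub conn] obtain C where C: "C \<subseteq> E" "even_set t h C"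
      "C \<inter> induced t h E ?U = {}" "pair_coverable t h E (?F \<union> C)"
      by blast
    \<comment> \<open>The two links are closed up to an even set by a join in \<open>F\<close> and
      one in \<open>K\<close>. Either join may have equal ends.\<close>
    obtain J where J: "J \<subseteq> F" "\<And>v. odd_at t h J v \<longleftrightarrow> (v = u) \<noteq> (v = u')"
      using connects_join[OF finF F(2) e(4,5)] by metis
    obtain L where L: "L \<subseteq> K" "\<And>v. odd_at t h L v \<longleftrightarrow> (v = x) \<noteq> (v = y)"
      using connects_join[OF finK K(3) e(6,7)] by metis
    note finJL = finite_subset[OF J(1) finF] finite_subset[OF L(1) finK]
    have odd_JL: "odd_at t h (J \<union> L) v \<longleftrightarrow> (((v = u) \<noteq> (v = u')) \<noteq> ((v = x) \<noteq> (v = y)))" for v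
    proof -
      have "J \<inter> L = {}" using J(1) L(1) FK by blast
      then show ?thesis by (simp only: odd_at_disjoint_Un[OF finJL] J(2) L(2))
    qed
    have odd_link: "odd_at t h {f} v \<longleftrightarrow> (v = a) \<noteq> (v = b)" if "link f a b" for f a b v
      using that unfolding link_def doubleton_eq_iff by auto
    have odd_e: "odd_at t h ({e} \<union> {e'}) v \<longleftrightarrow>
        (((v = u) \<noteq> (v = x)) \<noteq> ((v = u') \<noteq> (v = y)))" for v
    proof -
      have "odd_at t h ({e} \<union> {e'}) v \<longleftrightarrow> (odd_at t h {e} v \<noteq> odd_at t h {e'} v)"
        by (rule odd_at_disjoint_Un) (use e(3) in auto)
      then show ?thesis by (simp only: odd_link[OF e(1)] odd_link[OF e(2)])
    qed
    have disj: "({e} \<union> {e'}) \<inter> (J \<union> L) = {}" using J(1) L(1) F(1) K(1) enU by blast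
    have Z: "even_set t h (({e} \<union> {e'}) \<union> (J \<union> L))"
      unfolding even_set_def
    proof
      fix v
      have "odd_at t h (({e} \<union> {e'}) \<union> (J \<union> L)) v \<longleftrightarrow>
          (odd_at t h ({e} \<union> {e'}) v \<noteq> odd_at t h (J \<union> L) v)"
        by (rule odd_at_disjoint_Un) (use finJL disj in auto)
      then show "\<not> odd_at t h (({e} \<union> {e'}) \<union> (J \<union> L)) v"
        using odd_JL[of v] odd_e[of v] by argo
    qed
    have CK: "C \<inter> K = {}" using C(3) K(1) unfolding induced_def by blast
    have "pair_coverable t h E (F \<union> (C \<union> K))"
    proof (rule pair_coverable_step[OF finE _ Z])
      show "pair_coverable t h E (F \<union> (C \<union> K) \<union> {e, e'})"
        using C(4) by (simp add: Un_ac)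
    qed (use C FE KE J(1) L(1) eE in auto)
    moreover have "even_set t h (C \<union> K)"
      unfolding even_set_def using C(2) K(2) odd_at_disjoint_Un[OF _ finK CK, of t h]
        finite_subset[OF C(1) finE] unfolding even_set_def by blast
    moreover have "(C \<union> K) \<inter> induced t h E U = {}"
      using C(3) K(1) W(2) unfolding induced_def by blast
    ultimately show ?thesis using C(1) KE by (intro exI[of _ "C \<union> K"]) auto
  qed
  show ?case
  proof (cases "U = V")
    case True
    then show ?thesis
      using connects_pair_coverable[OF finE FE, of t V h] V F(2) by (intro exI[of _ "{}"]) auto
  next
    case False
    show ?thesis
    proof (cases "\<exists>w \<in> V - U. \<exists>e e' u u'. e \<noteq> e' \<and> u \<in> U \<and> u' \<in> U \<and> link e u w \<and> link e' u' w")
      case True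
      then obtain w e e' u u' where w: "w \<in> V - U" "e \<noteq> e'" "u \<in> U" "u' \<in> U"
        "link e u w" "link e' u' w" by blast
      \<comment> \<open>A single vertex with two links to \<open>U\<close> needs no edges to be
        connected.\<close>
      show ?thesis
        by (rule step[of "{w}" "{}" e u w e' u' w]) (use w in \<open>auto simp: connects_def\<close>)
    next
      case unique: False
      \<comment> \<open>In the minimal set \<open>B\<close> with at most one edge to the rest of \<open>V - U\<close>, all cuts of the
        subgraph induced by \<open>B\<close> have at least two edges.\<close>
      define H where "H = induced t h E (V - U)"
      define \<B> where "\<B> = {B. B \<subseteq> V - U \<and> B \<noteq> {} \<and> card (boundary t h H B) \<le> 1}"
      have finH: "finite H" using finE by (simp add: H_def induced_def)
      have "boundary t h H (V - U) = {}" by (auto simp: H_def induced_def boundary_def)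
      then have "V - U \<in> \<B>" using False U unfolding \<B>_def by auto
      moreover have "finite \<B>" using finV unfolding \<B>_def by auto
      ultimately obtain B where B: "B \<in> \<B>" and min: "\<And>A. A \<in> \<B> \<Longrightarrow> A \<subseteq> B \<Longrightarrow> A = B"
        using finite_has_minimal[of \<B>] by (metis empty_iff)
      have B': "B \<subseteq> V - U" "B \<noteq> {}" "card (boundary t h H B) \<le> 1" using B unfolding \<B>_def by auto
      have "B \<subset> V" using B' U by blast
      then have three: "3 \<le> card (boundary t h E B)" using con3 B' by blast
      \<comment> \<open>At least three edges leave \<open>B\<close> and at most one of them stays in
        \<open>V - U\<close>, so two or more go to \<open>U\<close>.\<close>
      define S where "S = boundary t h E B - boundary t h H B"
      have "2 \<le> card S"
        using three B'(3) diff_card_le_card_Diff[of "boundary t h H B" "boundary t h E B"] finH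
        unfolding S_def by auto
      then obtain e e' where ee: "e \<in> S" "e' \<in> S" "e \<noteq> e'"
        by (metis card_2_iff' obtain_subset_with_card_n subsetD)
      have link_S: "\<exists>u x. link f u x \<and> u \<in> U \<and> x \<in> B" if "f \<in> S" for f
        using that V[of f] B'(1)
        unfolding S_def boundary_def H_def induced_def link_def by (auto simp: insert_commute)
      obtain u x where e: "link e u x" "u \<in> U" "x \<in> B" using link_S[OF ee(1)] by blast
      obtain u' y where e': "link e' u' y" "u' \<in> U" "y \<in> B" using link_S[OF ee(2)] by blast
      have "x \<noteq> y" using unique e e' ee(3) B'(1) by blast
      define EB where "EB = induced t h E B"
      have finEB: "finite EB" using finE by (simp add: EB_def induced_def)
      have "two_joined t h EB x y"
        unfolding two_joined_def
      proof (intro allI impI)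
        fix X assume X: "x \<in> X" "y \<notin> X"
        have big: "2 \<le> card (boundary t h H A)" if "A \<subset> B" "A \<noteq> {}" for A
          using min[of A] that B'(1) unfolding \<B>_def by force
        have one: "2 \<le> card (boundary t h EB X)"
          if A: "A \<subset> B" "A \<noteq> {}" "\<And>f. f \<in> boundary t h H B \<Longrightarrow> t f \<notin> A \<and> h f \<notin> A"
            "A = B \<inter> X \<or> A = B - X" for A
        proof -
          have "boundary t h H A \<subseteq> boundary t h EB X"
            using A B'(1) unfolding boundary_def EB_def H_def induced_def by blast
          then show ?thesis using big[OF A(1,2)] card_mono[of "boundary t h EB X"] finEB
            by (meson finite_boundary le_trans)
        qed
        \<comment> \<open>At most one edge of \<open>H\<close> leaves \<open>B\<close>, and its end
          in \<open>B\<close> lies on one side of \<open>X\<close> only. On the other side, all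
          edges of \<open>H\<close> leaving \<open>A\<close> end in \<open>B\<close> and cross
          \<open>X\<close>; minimality of \<open>B\<close> gives two of them.\<close>
        have "\<exists>A \<in> {B \<inter> X, B - X}. \<forall>f \<in> boundary t h H B. t f \<notin> A \<and> h f \<notin> A"
        proof (cases "boundary t h H B = {}")
          case False
          then obtain f where f: "boundary t h H B = {f}"
            using B'(3) finH card_le_Suc0_iff_eq[of "boundary t h H B"] by auto
          then have "(t f \<in> B) \<noteq> (h f \<in> B)" unfolding boundary_def by blast
          then show ?thesis unfolding f by auto
        qed auto
        then show "2 \<le> card (boundary t h EB X)"
          using one[of "B \<inter> X"] one[of "B - X"] X e(3) e'(3) by blast
      qed
      from ex_connected_even_set[OF finEB this \<open>x \<noteq> y\<close>] obtain K W where KW: "K \<subseteq> EB"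
        "even_set t h K" "x \<in> W" "y \<in> W" "induced t h K W = K"
        "connects t h K W" "\<And>X. x \<in> X \<Longrightarrow> boundary t h K X = {} \<Longrightarrow> W \<subseteq> X" by metis
      have "boundary t h K B = {}" using KW(1) unfolding EB_def induced_def boundary_def by blast
      then have "W \<subseteq> B" using KW(7) e(3) by blast
      moreover have "K \<subseteq> induced t h E W" using KW(1,5) unfolding EB_def induced_def by blast
      ultimately show ?thesis
        using step[of W K e u x e' u' y] B'(1) KW e e' ee by blast
    qed
  qed
qed

lemma ex_three_even_cover:
  assumes finE: "finite E" and finV: "finite V"
    and V: "\<And>e. e \<in> E \<Longrightarrow> t e \<in> V \<and> h e \<in> V"
    and con3: "\<And>X. X \<noteq> {} \<Longrightarrow> X \<subset> V \<Longrightarrow> 3 \<le> card (boundary t h E X)"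
  obtains A B C where "even_set t h A" "even_set t h B" "even_set t h C" "A \<union> B \<union> C = E"
proof (cases "V = {}")
  case True
  then have "E = {}" using V by blast
  then show ?thesis using that[of "{}" "{}" "{}"] by simp
next
  case False
  then obtain r where r: "r \<in> V" by blast
  have "connects t h {} {r}" by (auto simp: connects_def)
  then obtain C where C: "C \<subseteq> E" "even_set t h C" "pair_coverable t h E ({} \<union> C)"
    using ex_disjoint_even_extension[OF finE finV V con3, of "{r}" "{}"] r by auto
  then obtain P Q where "P \<subseteq> E" "Q \<subseteq> E" "even_set t h P" "even_set t h Q" "E - C \<subseteq> P \<union> Q"
    unfolding pair_coverable_def by auto
  then show ?thesis using that[of P Q C] C by blast
qed

section \<open>Integer flows and deletable arcs\<close>

text \<open>The net flow out of \<open>X\<close>, with \<open>t\<close> and \<open>h\<close> as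
  reference orientation. Edges inside \<open>X\<close> and loops cancel.\<close>

definition excess :: "('e \<Rightarrow> 'v) \<Rightarrow> ('e \<Rightarrow> 'v) \<Rightarrow> 'e set \<Rightarrow> ('e \<Rightarrow> int) \<Rightarrow> 'v set \<Rightarrow> int" where
  "excess t h E f X = (\<Sum>e\<in>E. f e * (of_bool (t e \<in> X) - of_bool (h e \<in> X)))"

lemma excess_eq_0:
  assumes "finite X" "\<And>v. excess t h E f {v} = 0"
  shows "excess t h E f X = 0"
  using assms(1)
proof (induction X rule: finite_induct)
  case empty
  show ?case by (simp add: excess_def)
next
  case (insert v X)
  have "excess t h E f (insert v X) = excess t h E f {v} + excess t h E f X"
    unfolding excess_def sum.distrib[symmetric]
    by (rule sum.cong) (use insert.hyps in auto)
  with insert.IH assms(2) show ?case by simp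
qed

text \<open>Two edges meeting in \<open>v\<close> are split off at \<open>v\<close>, i.e. replaced by one edge joining
  their other endvertices.\<close>

lemma even_set_unit_flow:
  assumes "finite C" "even_set t h C"
  shows "\<exists>s. (\<forall>e \<in> C. s e = 1 \<or> s e = -1) \<and> (\<forall>v. excess t h C s {v} = 0)"
  using assms
proof (induction "card C" arbitrary: C h rule: less_induct)
  case less
  note fin = less.prems(1)
  show ?case
  proof (cases "C = {}")
    case True
    then show ?thesis by (simp add: excess_def)
  next
    case False
    then obtain e where e: "e \<in> C" by blast
    have smaller: "card (C - {f}) < card C" if "f \<in> C" for f
      using that fin by (meson card_Diff1_less)
    show ?thesis
    proof (cases "t e = h e")
      case True
      \<comment> \<open>Splitting off may create loops. They affect neither parity nor excess, so a
        loop can take the value 1.\<close>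
      have eq: "C = {e} \<union> (C - {e})" using e by blast
      have "odd_at t h C v = odd_at t h (C - {e}) v" for v
        by (subst eq, subst odd_at_disjoint_Un) (use fin True in auto)
      then have "even_set t h (C - {e})" using less.prems(2) unfolding even_set_def by simp
      from less.hyps[OF smaller[OF e] _ this] fin obtain s
        where s: "\<forall>e \<in> C - {e}. s e = 1 \<or> s e = -1" "\<And>v. excess t h (C - {e}) s {v} = 0" by auto
      define s' where "s' = s(e := 1)"
      have "excess t h C s' {v} = excess t h (C - {e}) s {v}" for v
        unfolding excess_def sum.remove[OF fin e] s'_def using True by simp
      then show ?thesis using s by (intro exI[of _ s']) (auto simp: s'_def)
    next
      case False
      define v where "v = h e"
      have "e \<in> boundary t h C {v}" using e False by (auto simp: boundary_def v_def)
      moreover have "even (card (boundary t h C {v}))"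
        using less.prems(2) unfolding even_set_def odd_at_def by blast
      ultimately have "boundary t h C {v} \<noteq> {e}" by force
      then obtain f where f: "f \<in> boundary t h C {v}" "f \<noteq> e"
        using \<open>e \<in> boundary t h C {v}\<close> by blast
      have fC: "f \<in> C" and fv: "(t f = v) \<noteq> (h f = v)" using f by (auto simp: boundary_def)
      define u where "u = (if t f = v then h f else t f)"
      \<comment> \<open>The new edge runs from \<open>t e\<close> to \<open>u\<close>. Its flow is
        routed along \<open>e\<close> into \<open>v\<close> and on along \<open>f\<close>, and
        \<open>\<sigma>\<close> corrects the sign if \<open>f\<close> points towards
        \<open>v\<close>.\<close>
      define \<sigma> :: int where "\<sigma> = (if t f = v then 1 else -1)"
      define h' where "h' = h(e := u)"
      define R where "R = C - {e, f}"
      have finR: "finite R" using fin by (simp add: R_def)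
      have C_eq: "C = ({e} \<union> {f}) \<union> R" and Cf_eq: "C - {f} = {e} \<union> R"
        using e fC f(2) by (auto simp: R_def)
      have hR: "boundary t h' R X = boundary t h R X" for X
        by (auto simp: boundary_def R_def h'_def)
      have "odd_at t h' (C - {f}) w = odd_at t h C w" for w
      proof -
        have "odd_at t h' (C - {f}) w \<longleftrightarrow> (odd_at t h' {e} w \<noteq> odd_at t h' R w)"
          unfolding Cf_eq by (rule odd_at_disjoint_Un) (use finR in \<open>auto simp: R_def\<close>)
        moreover have "odd_at t h C w \<longleftrightarrow> (odd_at t h ({e} \<union> {f}) w \<noteq> odd_at t h R w)"
          by (subst C_eq, rule odd_at_disjoint_Un) (use finR in \<open>auto simp: R_def\<close>)
        moreover have "odd_at t h ({e} \<union> {f}) w \<longleftrightarrow> (odd_at t h {e} w \<noteq> odd_at t h {f} w)"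
          by (rule odd_at_disjoint_Un) (use f in auto)
        moreover have "odd_at t h' R w = odd_at t h R w" by (simp add: odd_at_def hR)
        ultimately show ?thesis using fv by (auto simp: h'_def u_def v_def)
      qed
      then have "even_set t h' (C - {f})" using less.prems(2) unfolding even_set_def by simp
      from less.hyps[OF smaller[OF fC] _ this] fin obtain s
        where s: "\<forall>e \<in> C - {f}. s e = 1 \<or> s e = -1" "\<And>v. excess t h' (C - {f}) s {v} = 0" by auto
      define s' where "s' = s(f := \<sigma> * s e)"
      have "excess t h C s' {w} = excess t h' (C - {f}) s {w}" for w
      proof -
        have R: "(\<Sum>x\<in>R. s' x * (of_bool (t x \<in> {w}) - of_bool (h x \<in> {w})))
            = (\<Sum>x\<in>R. s x * (of_bool (t x \<in> {w}) - of_bool (h' x \<in> {w})))"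
          by (rule sum.cong) (auto simp: R_def s'_def h'_def)
        have "excess t h C s' {w} = s' e * (of_bool (t e = w) - of_bool (h e = w))
            + s' f * (of_bool (t f = w) - of_bool (h f = w))
            + (\<Sum>x\<in>R. s' x * (of_bool (t x \<in> {w}) - of_bool (h x \<in> {w})))"
          unfolding excess_def by (subst C_eq) (use finR f in \<open>simp add: R_def\<close>)
        moreover have "excess t h' (C - {f}) s {w} = s e * (of_bool (t e = w) - of_bool (h' e = w))
            + (\<Sum>x\<in>R. s x * (of_bool (t x \<in> {w}) - of_bool (h' x \<in> {w})))"
          unfolding excess_def Cf_eq using finR by (simp add: R_def)
        moreover have "s' e * (of_bool (t e = w) - of_bool (h e = w))
            + s' f * (of_bool (t f = w) - of_bool (h f = w))
            = s e * (of_bool (t e = w) - of_bool (h' e = w))"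
          using fv f(2) by (auto simp: s'_def h'_def \<sigma>_def u_def v_def algebra_simps)
        ultimately show ?thesis using R by simp
      qed
      then show ?thesis
        using s e f(2) by (intro exI[of _ s']) (auto simp: s'_def \<sigma>_def)
    qed
  qed
qed

lemma even_set_flow:
  assumes "finite E" "C \<subseteq> E" "even_set t h C"
  obtains s where "\<And>e. e \<in> C \<Longrightarrow> \<bar>s e\<bar> = 1" "\<And>e. e \<notin> C \<Longrightarrow> s e = 0"
    "\<And>v. excess t h E s {v} = 0"
proof -
  obtain s where s: "\<forall>e \<in> C. s e = 1 \<or> s e = -1" "\<And>v. excess t h C s {v} = 0"
    using even_set_unit_flow assms finite_subset by metis
  define s' where "s' e = (if e \<in> C then s e else 0)" for e
  have "excess t h E s' {v} = excess t h C s {v}" for v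
    unfolding excess_def
    by (rule sum.mono_neutral_cong_right) (use assms in \<open>auto simp: s'_def\<close>)
  then show thesis
    by (intro that[of s']) (use s in \<open>auto simp: s'_def\<close>)
qed

text \<open>If \<open>f\<close> is a nowhere zero flow, its absolute values form a positive flow in
  this orientation.\<close>

definition positive_orientation ::
    "('v, 'e) mgraph \<Rightarrow> ('e \<Rightarrow> 'v) \<Rightarrow> ('e \<Rightarrow> 'v) \<Rightarrow> ('e \<Rightarrow> int) \<Rightarrow> ('v, 'e) pre_digraph" where
  "positive_orientation G t h f = \<lparr>verts = mverts G, arcs = medges G,
    tail = (\<lambda>e. if 0 < f e then t e else h e), head = (\<lambda>e. if 0 < f e then h e else t e)\<rparr>"

text \<open>If an arc of flow value 1 were the only one leaving \<open>X\<close>, then at least two arcs, each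
  of flow value at least 1, would enter \<open>X\<close>.\<close>

lemma strong_del_unit_arc:
  assumes finV: "finite (mverts G)" and fin: "finite (medges G)"
    and con3: "\<And>X. X \<noteq> {} \<Longrightarrow> X \<subset> mverts G \<Longrightarrow> 3 \<le> card (boundary t h (medges G) X)"
    and f: "\<And>e. e \<in> medges G \<Longrightarrow> f e \<noteq> 0" "\<And>v. excess t h (medges G) f {v} = 0"
    and e0: "e0 \<in> medges G" "\<bar>f e0\<bar> = 1"
  shows "strong (pre_digraph.del_arc (positive_orientation G t h f) e0)"
proof -
  let ?D = "positive_orientation G t h f" and ?E = "medges G"
  have "\<exists>a \<in> ?E - {e0}. tail ?D a \<in> X \<and> head ?D a \<notin> X" if X: "X \<noteq> {}" "X \<subset> mverts G" for X
  proof (rule ccontr)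
    assume none: "\<not> ?thesis"
    let ?B = "boundary t h ?E X"
    \<comment> \<open>The arc \<open>e0\<close> carries at most 1 out of \<open>X\<close>; every
      other boundary arc enters \<open>X\<close> and contributes at most -1.\<close>
    have le: "f e * (of_bool (t e \<in> X) - of_bool (h e \<in> X))
        \<le> of_bool (e = e0) - of_bool (e \<in> ?B - {e0})" if "e \<in> ?E" for e
    proof (cases "e = e0")
      case True
      then show ?thesis using e0(2) by auto
    next
      case False
      then have "\<not> (tail ?D e \<in> X \<and> head ?D e \<notin> X)" using none that by blast
      then show ?thesis using False that f(1)[OF that]
        by (cases "0 < f e"; cases "t e \<in> X"; cases "h e \<in> X")
          (simp_all add: positive_orientation_def boundary_def)
    qed
    have "finite X" using X finV finite_subset by blast
    then have "0 = excess t h ?E f X" using f(2) by (simp add: excess_eq_0)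
    also have "\<dots> \<le> (\<Sum>e\<in>?E. of_bool (e = e0) - of_bool (e \<in> ?B - {e0}))"
      unfolding excess_def by (rule sum_mono) (rule le)
    also have "\<dots> = (\<Sum>e\<in>?E. of_bool (e = e0)) - (\<Sum>e\<in>?E. of_bool (e \<in> ?B - {e0}))"
      by (rule sum_subtractf)
    also have "(\<Sum>e\<in>?E. of_bool (e = e0)) = (1 :: int)"
      using fin e0(1) by (simp add: of_bool_def)
    also have "(\<Sum>e\<in>?E. of_bool (e \<in> ?B - {e0})) = int (card (?B - {e0}))"
    proof -
      have "?E \<inter> {e. e \<in> ?B - {e0}} = ?B - {e0}" by (auto simp: boundary_def)
      then show ?thesis using fin by (simp add: sum_of_bool_eq)
    qed
    finally have "card (?B - {e0}) \<le> 1" by simp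
    moreover have "card ?B \<le> card (?B - {e0}) + 1"
      using diff_card_le_card_Diff[of "{e0}" ?B] by simp
    ultimately show False using con3[OF X] by linarith
  qed
  moreover have "verts (pre_digraph.del_arc ?D e0) = mverts G"
    "arcs (pre_digraph.del_arc ?D e0) = ?E - {e0}"
    "tail (pre_digraph.del_arc ?D e0) = tail ?D" "head (pre_digraph.del_arc ?D e0) = head ?D"
    by (simp_all add: pre_digraph.del_arc_def positive_orientation_def)
  ultimately show ?thesis unfolding strong_def by metis
qed

lemma ex_deleting_orientation:
  assumes "multigraph G"
    and ends: "\<And>e. e \<in> medges G \<Longrightarrow> {t e, h e} = mends G e"
    and con3: "\<And>X. X \<noteq> {} \<Longrightarrow> X \<subset> mverts G \<Longrightarrow> 3 \<le> card (boundary t h (medges G) X)"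
    and ev: "even_set t h A" "even_set t h B" "even_set t h C" "A \<union> B \<union> C = medges G"
  shows "\<exists>D. orientation G D \<and> (\<forall>e \<in> A - B - C. strong (pre_digraph.del_arc D e))"
proof -
  interpret multigraph G by fact
  let ?E = "medges G"
  obtain a where a: "\<And>e. e \<in> A \<Longrightarrow> \<bar>a e\<bar> = 1" "\<And>e. e \<notin> A \<Longrightarrow> a e = 0"
      "\<And>v. excess t h ?E a {v} = 0"
    using even_set_flow[OF finite_medges _ ev(1)] ev(4) by blast
  obtain b where b: "\<And>e. e \<in> B \<Longrightarrow> \<bar>b e\<bar> = 1" "\<And>e. e \<notin> B \<Longrightarrow> b e = 0"
      "\<And>v. excess t h ?E b {v} = 0"
    using even_set_flow[OF finite_medges _ ev(2)] ev(4) by blast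
  obtain c where c: "\<And>e. e \<in> C \<Longrightarrow> \<bar>c e\<bar> = 1" "\<And>e. e \<notin> C \<Longrightarrow> c e = 0"
      "\<And>v. excess t h ?E c {v} = 0"
    using even_set_flow[OF finite_medges _ ev(3)] ev(4) by blast
  \<comment> \<open>The largest weight present exceeds the sum of the smaller ones, so no choice of
    signs gives zero.\<close>
  define f where "f e = a e + 2 * b e + 4 * c e" for e
  have nz: "f e \<noteq> 0" if "e \<in> ?E" for e
    using that ev(4) a(1,2)[of e] b(1,2)[of e] c(1,2)[of e] unfolding f_def
    by (cases "e \<in> A"; cases "e \<in> B"; cases "e \<in> C") auto
  have ex: "excess t h ?E f {v} = 0" for v
  proof -
    have "excess t h ?E f {v} = excess t h ?E a {v} + 2 * excess t h ?E b {v} + 4 * excess t h ?E c {v}"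
      unfolding excess_def f_def sum_distrib_left sum.distrib[symmetric]
      by (rule sum.cong) (auto simp: algebra_simps)
    then show ?thesis using a(3) b(3) c(3) by simp
  qed
  have "strong (pre_digraph.del_arc (positive_orientation G t h f) e)" if "e \<in> A - B - C" for e
    by (rule strong_del_unit_arc[OF finite_mverts finite_medges con3 nz ex])
      (use that ev(4) a(1) b(2) c(2) in \<open>auto simp: f_def\<close>)
  moreover have "orientation G (positive_orientation G t h f)"
    unfolding orientation_def positive_orientation_def using ends by (auto simp: insert_commute)
  ultimately show ?thesis by blast
qed

section \<open>Seven orientations from a cover by three even sets\<close>

theorem theorem2:
  fixes G :: "('v, 'e) mgraph"
  assumes "multigraph G"
    and "edge_connected 3 G"
  shows "frank_number G \<le> 7"
proof -
  interpret multigraph G by fact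
  let ?E = "medges G" and ?V = "mverts G"
  have "\<forall>e \<in> ?E. \<exists>p. {fst p, snd p} = mends G e"
    using card_mends by (metis card_2_iff fst_conv snd_conv)
  then obtain p where p: "\<And>e. e \<in> ?E \<Longrightarrow> {fst (p e), snd (p e)} = mends G e" by metis
  define t where "t e = fst (p e)" for e
  define h where "h e = snd (p e)" for e
  have ends: "{t e, h e} = mends G e" if "e \<in> ?E" for e
    using p[OF that] by (simp add: t_def h_def)
  have V: "t e \<in> ?V \<and> h e \<in> ?V" if "e \<in> ?E" for e
    using ends[OF that] mends_subset[OF that] by blast
  have cut: "cut G X = boundary t h ?E X" for X
  proof -
    have "card (mends G e \<inter> X) = 1 \<longleftrightarrow> (t e \<in> X) \<noteq> (h e \<in> X)" if "e \<in> ?E" for e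
    proof -
      have "t e \<noteq> h e" using card_mends[OF that] unfolding ends[OF that, symmetric] by auto
      then show ?thesis
        unfolding ends[OF that, symmetric]
        by (cases "t e \<in> X"; cases "h e \<in> X") (simp_all add: Int_insert_left)
    qed
    then show ?thesis unfolding cut_def boundary_def by blast
  qed
  have con3: "3 \<le> card (boundary t h ?E X)" if "X \<noteq> {}" "X \<subset> ?V" for X
    using assms(2) that unfolding edge_connected_def cut by blast
  obtain A B C where ev: "even_set t h A" "even_set t h B" "even_set t h C"
    and cov: "A \<union> B \<union> C = ?E"
    using ex_three_even_cover[OF finite_medges finite_mverts V con3] by metis
  have fin: "finite A" "finite B" "finite C" using cov finite_medges by (auto intro: finite_subset)
  have AB: "even_set t h (sym_diff A B)" and AC: "even_set t h (sym_diff A C)"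
    and BC: "even_set t h (sym_diff B C)"
    using ev fin by (auto intro!: even_set_sym_diff)
  define good where "good S \<longleftrightarrow> (\<exists>D. orientation G D \<and> (\<forall>e \<in> S. strong (pre_digraph.del_arc D e)))"
    for S
  have good: "good (X - Y - Z)"
    if "even_set t h X" "even_set t h Y" "even_set t h Z" "X \<union> Y \<union> Z = ?E" for X Y Z
    using ex_deleting_orientation[OF assms(1) ends con3 that] unfolding good_def by blast
  \<comment> \<open>The seven classes of edges according to the nonempty set of those of \<open>A\<close>, \<open>B\<close>, \<open>C\<close>
    containing them, each written in terms of a suitable basis.\<close>
  define S where "S = [A - B - C, B - A - C, C - A - B, A - sym_diff A B - C,
    A - sym_diff A C - B, B - sym_diff B C - A, A - sym_diff A B - sym_diff A C]"
  have "good s" if "s \<in> set S" for s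
  proof -
    \<comment> \<open>Each triple still covers all edges, as \<open>A\<close> and
      \<open>sym_diff A B\<close> together contain \<open>B\<close>, and similarly for the
      others.\<close>
    have "good (A - B - C)" "good (B - A - C)" "good (C - A - B)" "good (A - sym_diff A B - C)"
      "good (A - sym_diff A C - B)" "good (B - sym_diff B C - A)"
      "good (A - sym_diff A B - sym_diff A C)"
      by (rule good; use ev AB AC BC cov in \<open>(assumption | blast)\<close>)+
    then show ?thesis using that unfolding S_def by auto
  qed
  then obtain D where D: "\<And>s. s \<in> set S \<Longrightarrow> orientation G (D s)"
    "\<And>s e. s \<in> set S \<Longrightarrow> e \<in> s \<Longrightarrow> strong (pre_digraph.del_arc (D s) e)"
    unfolding good_def by metis
  have len: "length S = 7" by (simp add: S_def)
  have "frank_orientations G 7"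
    unfolding frank_orientations_def
  \<comment> \<open>Orientations are numbered from 1, list entries from 0.\<close>
  proof (intro exI[of _ "\<lambda>i. D (S ! (i - 1))"] conjI ballI)
    fix i :: nat assume "i \<in> {1..7}"
    then show "orientation G (D (S ! (i - 1)))" using len by (intro D(1) nth_mem) auto
  next
    fix e assume "e \<in> ?E"
    then have "\<exists>s \<in> set S. e \<in> s" using cov unfolding S_def by auto
    then obtain j where j: "j < 7" "e \<in> S ! j" by (metis in_set_conv_nth len)
    then have "strong (pre_digraph.del_arc (D (S ! j)) e)" using D(2) len nth_mem by metis
    then show "\<exists>i \<in> {1..7}. strong (pre_digraph.del_arc (D (S ! (i - 1))) e)"
      using j(1) by (intro bexI[of _ "Suc j"]) auto
  qed
  then have "frank_number G \<le> enat 7" unfolding frank_number_def by (intro INF_lower) simp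
  then show ?thesis by (simp add: numeral_eq_enat)
qed

end
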